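(* Let $K$ be a field, $G$ a finite group and $\mathcal{C}\leq KG$ a nonzero $G$-code. Then $$d(\mathcal{C})\cdot \dim\mathcal{C}\geq |G|.$$ In particular, $$2\sqrt{|G|}\leq d(\mathcal{C})+\dim\mathcal{C}\leq |G|+1.$$
   Context: $KG$ is the group algebra of $G$ over $K$. A $G$-code over $K$ is a right ideal $\mathcal{C}$ of $KG$ (written $\mathcal{C}\leq KG$); $\dim\mathcal{C}$ is its dimension over $K$. For $f=\sum_{g\in G}a_g g\in KG$ the weight is $\mathrm{wt}(f)=|\{g\in G\mid a_g\neq 0\}|$, and the minimum distance of a nonzero $G$-code is $d(\mathcal{C})=\min\{\mathrm{wt}(c)\mid c\in\mathcal{C},\ c\neq 0\}$. *)

theory Defs
  imports Complex_Main "HOL-Library.Poly_Mapping" "HOL-Library.Cardinality"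
begin

text \<open>
  The group \<open>G\<close> is a type of class \<open>group_add\<close>: the group operation is written \<open>+\<close>, with neutral
  element \<open>0\<close>, and is not assumed commutative. With this reading \<open>G \<Rightarrow>\<^sub>0 K\<close> carries the convolution
  product \<open>single g a * single h b = single (g + h) (a * b)\<close> and \<open>1 = single 0 1\<close>,
  so it is the group algebra \<open>KG\<close>.
\<close>

type_synonym ('g, 'k) group_algebra = "'g \<Rightarrow>\<^sub>0 'k"

definition scale_KG :: "'k::field \<Rightarrow> ('g, 'k) group_algebra \<Rightarrow> ('g, 'k) group_algebra"
  where "scale_KG a f = Poly_Mapping.map ((*) a) f"

lemma lookup_scale_KG: "Poly_Mapping.lookup (scale_KG a f) g = a * Poly_Mapping.lookup f g"
  unfolding scale_KG_def by (simp add: Poly_Mapping.map.rep_eq when_def)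

interpretation KG: vector_space scale_KG
  by unfold_locales
    (auto intro!: poly_mapping_eqI simp: lookup_scale_KG lookup_add algebra_simps)

definition G_code :: "('g::group_add, 'k::field) group_algebra set \<Rightarrow> bool"
  where "G_code C \<longleftrightarrow>
    0 \<in> C \<and> (\<forall>x\<in>C. \<forall>y\<in>C. x - y \<in> C) \<and> (\<forall>x\<in>C. \<forall>a. x * a \<in> C)"

lemma single_zero_mult:
  fixes f :: "('g::group_add, 'k::field) group_algebra"
  shows "f * Poly_Mapping.single 0 a = scale_KG a f"
proof (rule poly_mapping_eqI)
  fix k :: 'g
  have "(\<Sum>q. Poly_Mapping.lookup (Poly_Mapping.single 0 a) q when k = l + q) = (a when l = k)" for l
  proof -
    have "(\<lambda>q. Poly_Mapping.lookup (Poly_Mapping.single 0 a) q when k = l + q)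
        = (\<lambda>q. (a when l = k) when q = 0)"
      by (auto simp: fun_eq_iff lookup_single when_def)
    then show ?thesis by (simp only: Sum_any_when_equal)
  qed
  then show "Poly_Mapping.lookup (f * Poly_Mapping.single 0 a) k
      = Poly_Mapping.lookup (scale_KG a f) k"
    by (simp add: lookup_scale_KG Poly_Mapping.times_poly_mapping.rep_eq prod_fun_def
        mult_when mult.commute)
qed

lemma G_code_subspace:
  fixes C :: "('g::group_add, 'k::field) group_algebra set"
  assumes "G_code C"
  shows "KG.subspace C"
proof (rule KG.subspaceI)
  show "0 \<in> C" using assms by (simp add: G_code_def)
  fix x y assume "x \<in> C" "y \<in> C"
  moreover from this have "0 - y \<in> C" using assms unfolding G_code_def by blast
  ultimately have "x - (0 - y) \<in> C" using assms unfolding G_code_def by blast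
  then show "x + y \<in> C" by simp
next
  fix a x assume "x \<in> C"
  then have "x * Poly_Mapping.single 0 a \<in> C" using assms by (simp add: G_code_def)
  then show "scale_KG a x \<in> C" by (simp add: single_zero_mult)
qed

definition weight :: "('g, 'k::field) group_algebra \<Rightarrow> nat"
  where "weight f = card {g. Poly_Mapping.lookup f g \<noteq> 0}"

definition min_dist :: "('g::finite, 'k::field) group_algebra set \<Rightarrow> nat"
  where "min_dist C = Min {weight c | c. c \<in> C \<and> c \<noteq> 0}"

end

(* Fix c of minimum weight d in C. The right translates c g lie in C and their supports
   cover G. A maximal linearly independent family of translates spans all of them, so the supports
   of its members, each of size d, already cover G, and the family has at most dim C members.
   The upper bound is the Singleton bound: restriction to |G| - d + 1 coordinates is injective on C. *)
theory Submission
  imports Defs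
begin

lemma weight_eq_card_keys: "weight f = card (Poly_Mapping.keys f)"
  by (simp add: weight_def Poly_Mapping.keys.rep_eq)

text \<open>In the convolution sum at \<open>k\<close>, the factor
  \<open>Poly_Mapping.single g a\<close> leaves only the pair \<open>(k - g, g)\<close>. As the
  group need not be commutative, the side matters: \<open>g\<close> is cancelled on the
  right.\<close>

lemma lookup_mult_single:
  fixes f :: "'g::group_add \<Rightarrow>\<^sub>0 'k::semiring_0"
  shows "Poly_Mapping.lookup (f * Poly_Mapping.single g a) k = Poly_Mapping.lookup f (k - g) * a"
proof -
  have "(\<Sum>q. Poly_Mapping.lookup (Poly_Mapping.single g a) q when k = l + q)
      = (a when l = k - g)" for l
  proof -
    have "(\<lambda>q. Poly_Mapping.lookup (Poly_Mapping.single g a) q when k = l + q)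
        = (\<lambda>q. (a when l = k - g) when q = g)"
      by (auto simp: fun_eq_iff lookup_single when_def)
    then show ?thesis by (simp only: Sum_any_when_equal)
  qed
  then show ?thesis
    by (simp add: Poly_Mapping.times_poly_mapping.rep_eq prod_fun_def mult_when)
qed

lemma keys_mult_single_one:
  fixes f :: "('g::group_add, 'k::field) group_algebra"
  shows "Poly_Mapping.keys (f * Poly_Mapping.single g 1) = (\<lambda>h. h + g) ` Poly_Mapping.keys f"
proof (intro set_eqI iffI)
  fix k assume "k \<in> Poly_Mapping.keys (f * Poly_Mapping.single g 1)"
  then have "k - g \<in> Poly_Mapping.keys f" by (simp add: in_keys_iff lookup_mult_single)
  then have "(k - g) + g \<in> (\<lambda>h. h + g) ` Poly_Mapping.keys f" by (rule imageI)
  then show "k \<in> (\<lambda>h. h + g) ` Poly_Mapping.keys f" by simp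
qed (auto simp: in_keys_iff lookup_mult_single)

text \<open>The elements supported in a fixed set form a subspace. This transfers a covering of the
  group by supports from a family of vectors to any set spanning that family.\<close>

lemma keys_span_subset:
  fixes v :: "('g, 'k::field) group_algebra"
  assumes "v \<in> KG.span B"
  shows "Poly_Mapping.keys v \<subseteq> (\<Union>b\<in>B. Poly_Mapping.keys b)"
proof -
  let ?V = "{v :: ('g, 'k) group_algebra. Poly_Mapping.keys v \<subseteq> (\<Union>b\<in>B. Poly_Mapping.keys b)}"
  have "KG.subspace ?V"
  proof (rule KG.subspaceI)
    fix x y assume "x \<in> ?V" "y \<in> ?V"
    then show "x + y \<in> ?V" using Poly_Mapping.keys_add[of x y] by blast
  next
    fix a x assume "x \<in> ?V"
    moreover have "Poly_Mapping.keys (scale_KG a x) \<subseteq> Poly_Mapping.keys x"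
      by (auto simp: in_keys_iff lookup_scale_KG)
    ultimately show "scale_KG a x \<in> ?V" by blast
  qed simp
  then have "KG.span B \<subseteq> ?V" by (intro KG.span_minimal) auto
  then show ?thesis using assms by blast
qed

text \<open>Expansion in the standard basis. With \<open>T = UNIV\<close> it gives a finite spanning
  set of the whole algebra, with smaller \<open>T\<close> a bound on the dimension of a space of
  coordinates.\<close>

lemma mem_span_singles:
  fixes f :: "('g, 'k::field) group_algebra"
  assumes "finite T" "Poly_Mapping.keys f \<subseteq> T"
  shows "f \<in> KG.span ((\<lambda>g. Poly_Mapping.single g 1) ` T)"
proof -
  have "f = (\<Sum>g\<in>T. scale_KG (Poly_Mapping.lookup f g) (Poly_Mapping.single g 1))"
  proof (rule poly_mapping_eqI)
    fix k
    have "(\<Sum>g\<in>T. Poly_Mapping.lookup f g * Poly_Mapping.lookup (Poly_Mapping.single g (1::'k)) k)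
        = (\<Sum>g\<in>T. if g = k then Poly_Mapping.lookup f k else 0)"
      by (intro sum.cong) (auto simp: lookup_single when_def)
    also have "\<dots> = Poly_Mapping.lookup f k"
      using assms by (auto simp: in_keys_iff)
    finally show "Poly_Mapping.lookup f k
        = Poly_Mapping.lookup (\<Sum>g\<in>T. scale_KG (Poly_Mapping.lookup f g) (Poly_Mapping.single g 1)) k"
      by (simp add: lookup_sum lookup_scale_KG)
  qed
  also have "\<dots> \<in> KG.span ((\<lambda>g. Poly_Mapping.single g 1) ` T)"
    by (intro KG.span_sum KG.span_scale KG.span_base) auto
  finally show ?thesis .
qed

text \<open>The interpretation \<open>KG\<close> is of a general vector space, so finiteness comes
  from the finitely many singles, which span everything. Exchange against a basis of
  \<open>V\<close> then bounds \<open>card B\<close>.\<close>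

lemma independent_card_le_dim:
  fixes V :: "('g::finite, 'k::field) group_algebra set"
  assumes "KG.independent B" "B \<subseteq> V"
  shows "finite B" "card B \<le> KG.dim V"
proof -
  obtain A where A: "A \<subseteq> V" "KG.independent A" "V \<subseteq> KG.span A" "card A = KG.dim V"
    by (rule KG.basis_exists)
  have "A \<subseteq> KG.span ((\<lambda>g. Poly_Mapping.single g 1) ` UNIV)"
    by (intro subsetI mem_span_singles) simp_all
  then have "finite A"
    using KG.independent_span_bound[OF _ A(2)] by (meson finite finite_imageI)
  moreover have "B \<subseteq> KG.span A" using assms(2) A(3) by simp
  ultimately have "finite B \<and> card B \<le> card A"
    using KG.independent_span_bound[OF _ assms(1)] by simp
  then show "finite B" "card B \<le> KG.dim V" using A(4) by simp_all
qed

text \<open>Stated for an arbitrary nonzero codeword; a codeword of minimum weight turns it into the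
  product bound.\<close>

lemma CARD_le_weight_mult_dim:
  fixes C :: "('g::{group_add, finite}, 'k::field) group_algebra set"
  assumes "G_code C" "c \<in> C" "c \<noteq> 0"
  shows "CARD('g) \<le> weight c * KG.dim C"
proof -
  define translate where "translate = (\<lambda>g. c * Poly_Mapping.single g (1::'k))"
  have translates: "range translate \<subseteq> C"
    using assms by (auto simp: G_code_def translate_def)
  have keys_translate: "Poly_Mapping.keys (translate g) = (\<lambda>h. h + g) ` Poly_Mapping.keys c" for g
    by (simp add: translate_def keys_mult_single_one)
  \<comment> \<open>The basis is chosen among the translates, not merely in \<open>C\<close>, so
    that every member has a support no larger than that of \<open>c\<close>.\<close>
  obtain B where B: "B \<subseteq> range translate" "KG.independent B" "range translate \<subseteq> KG.span B"
    by (rule KG.maximal_independent_subset)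
  have fin: "finite B" and card_B: "card B \<le> KG.dim C"
    using independent_card_le_dim[OF B(2)] B(1) translates by blast+
  obtain h where h: "h \<in> Poly_Mapping.keys c"
    using \<open>c \<noteq> 0\<close> by (metis keys_eq_empty all_not_in_conv)
  have "k \<in> (\<Union>b\<in>B. Poly_Mapping.keys b)" for k
  proof -
    \<comment> \<open>Right translation is transitive: the shift by \<open>- h + k\<close> carries
      the support point \<open>h\<close> to the given \<open>k\<close>.\<close>
    have "h + (- h + k) \<in> Poly_Mapping.keys (translate (- h + k))"
      using h unfolding keys_translate by blast
    then have "k \<in> Poly_Mapping.keys (translate (- h + k))" by (simp add: add.assoc[symmetric])
    then show ?thesis using keys_span_subset B(3) by blast
  qed
  then have "CARD('g) = card (\<Union>b\<in>B. Poly_Mapping.keys b)"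
    by (metis UNIV_eq_I)
  also have "\<dots> \<le> (\<Sum>b\<in>B. card (Poly_Mapping.keys b))" using fin by (rule card_UN_le)
  also have "\<dots> \<le> (\<Sum>b\<in>B. weight c)"
  proof (rule sum_mono)
    fix b assume "b \<in> B"
    then obtain g where "b = translate g" using B(1) by blast
    then show "card (Poly_Mapping.keys b) \<le> weight c"
      by (simp add: keys_translate weight_eq_card_keys card_image_le)
  qed
  also have "\<dots> = weight c * card B" by simp
  also have "\<dots> \<le> weight c * KG.dim C" using card_B by simp
  finally show ?thesis .
qed

text \<open>A nonzero vector of \<open>V\<close> that vanishes on |G| - d + 1 coordinates would have
  weight at most d - 1, so projection to these coordinates embeds \<open>V\<close>. For
  \<open>V = {0}\<close> the weight hypothesis is vacuous, hence the separate bound on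
  \<open>d\<close>.\<close>

lemma singleton_bound:
  fixes V :: "('g::finite, 'k::field) group_algebra set"
  assumes "KG.subspace V" and weight: "\<And>v. v \<in> V \<Longrightarrow> v \<noteq> 0 \<Longrightarrow> d \<le> weight v"
    and "d \<le> CARD('g)"
  shows "d + KG.dim V \<le> CARD('g) + 1"
proof (cases "d = 0")
  case True
  \<comment> \<open>For \<open>d = 0\<close> there are no |G| + 1 coordinates to choose; the claim
    follows from dim V \<le> |G|.\<close>
  let ?S = "(\<lambda>g::'g. Poly_Mapping.single g (1::'k)) ` UNIV"
  have "v \<in> KG.span ?S" for v by (rule mem_span_singles) simp_all
  then have "KG.dim V \<le> card ?S" by (intro KG.dim_le_card subsetI) simp_all
  also have "\<dots> \<le> CARD('g)" by (rule card_image_le) simp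
  finally show ?thesis using True by simp
next
  case False
  have "CARD('g) + 1 - d \<le> CARD('g)" using False by simp
  then obtain T :: "'g set" where T: "card T = CARD('g) + 1 - d"
    by (rule obtain_subset_with_card_n)
  \<comment> \<open>The projection is an endomorphism of the algebra that zeroes the coordinates
    outside \<open>T\<close>, so source and target share the scaling
    \<open>scale_KG\<close>.\<close>
  define restrict where
    "restrict = (\<lambda>f::('g, 'k) group_algebra.
      \<Sum>g\<in>T. Poly_Mapping.single g (Poly_Mapping.lookup f g))"
  have lookup_restrict: "Poly_Mapping.lookup (restrict f) k =
      (if k \<in> T then Poly_Mapping.lookup f k else 0)" for f k
  proof -
    have "Poly_Mapping.lookup (restrict f) k
        = (\<Sum>g\<in>T. if g = k then Poly_Mapping.lookup f k else 0)"
      unfolding restrict_def lookup_sum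
      by (intro sum.cong) (auto simp: lookup_single when_def)
    then show ?thesis by simp
  qed
  have "module_hom scale_KG scale_KG restrict"
    unfolding module_hom_iff
  proof (intro conjI allI KG.module_axioms)
    fix x y a
    show "restrict (x + y) = restrict x + restrict y"
      by (rule poly_mapping_eqI) (simp add: lookup_restrict lookup_add)
    show "restrict (scale_KG a x) = scale_KG a (restrict x)"
      by (rule poly_mapping_eqI) (simp add: lookup_restrict lookup_scale_KG)
  qed
  note inj_on_iff = module_hom.inj_on_iff_eq_0[OF this]
    and independent_image = module_hom.independent_injective_image[OF this]
  obtain A where A: "A \<subseteq> V" "KG.independent A" "V \<subseteq> KG.span A" "card A = KG.dim V"
    by (rule KG.basis_exists)
  \<comment> \<open>Preservation of independence requires injectivity on \<open>KG.span A\<close>;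
    this inclusion makes the weight bound available there.\<close>
  have span_A: "KG.span A \<subseteq> V" using A(1) \<open>KG.subspace V\<close> by (rule KG.span_minimal)
  have "v = 0" if "v \<in> KG.span A" "restrict v = 0" for v
  proof (rule ccontr)
    assume "v \<noteq> 0"
    then have "d \<le> card (Poly_Mapping.keys v)"
      using weight that(1) span_A by (auto simp: weight_eq_card_keys)
    moreover have "Poly_Mapping.keys v \<subseteq> - T"
    proof
      fix k assume "k \<in> Poly_Mapping.keys v"
      then show "k \<in> - T"
        using lookup_restrict[of v k] that(2) by (auto simp: in_keys_iff split: if_splits)
    qed
    then have "card (Poly_Mapping.keys v) \<le> card (- T)" by (intro card_mono) simp_all
    then have "card (Poly_Mapping.keys v) \<le> CARD('g) - card T"
      by (simp add: Compl_eq_Diff_UNIV card_Diff_subset)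
    \<comment> \<open>Here |G| - (|G| + 1 - d) = d - 1, which is strictly below \<open>d\<close>
      because \<open>d\<close> is nonzero.\<close>
    ultimately show False using T False \<open>d \<le> CARD('g)\<close> by simp
  qed
  then have inj: "inj_on restrict (KG.span A)"
    by (simp add: inj_on_iff[OF KG.subspace_span])
  have "restrict ` A \<subseteq> KG.span ((\<lambda>g. Poly_Mapping.single g 1) ` T)"
    by (auto intro!: mem_span_singles simp: in_keys_iff lookup_restrict split: if_splits)
  then have "card (restrict ` A) \<le> card ((\<lambda>g. Poly_Mapping.single g (1::'k)) ` T)"
    using KG.independent_span_bound[OF _ independent_image[OF A(2) inj]] by simp
  also have "\<dots> \<le> card T" by (simp add: card_image_le)
  also have "card (restrict ` A) = KG.dim V"
    using card_image[OF inj_on_subset[OF inj KG.span_superset]] A(4) by simp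
  finally show ?thesis using T \<open>d \<le> CARD('g)\<close> by simp
qed

text \<open>\<open>Min\<close> is meaningful only on a finite nonempty set: weights are at most |G|,
  and a nonzero codeword provides an element.\<close>

lemma min_dist_attained:
  fixes C :: "('g::finite, 'k::field) group_algebra set"
  assumes "0 \<in> C" "C \<noteq> {0}"
  obtains c where "c \<in> C" "c \<noteq> 0" "weight c = min_dist C"
    "\<And>x. x \<in> C \<Longrightarrow> x \<noteq> 0 \<Longrightarrow> min_dist C \<le> weight x"
proof -
  let ?W = "{weight c | c. c \<in> C \<and> c \<noteq> 0}"
  have "?W \<subseteq> {..CARD('g)}" by (auto simp: weight_def card_mono)
  then have fin: "finite ?W" by (rule finite_subset) simp
  have "?W \<noteq> {}" using assms by auto
  with fin have "min_dist C \<in> ?W" unfolding min_dist_def by (rule Min_in)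
  moreover have "min_dist C \<le> weight x" if "x \<in> C" "x \<noteq> 0" for x
    unfolding min_dist_def using that by (intro Min_le[OF fin]) auto
  ultimately show ?thesis using that by auto
qed

theorem corollary2p6:
  fixes C :: "('g::{group_add, finite}, 'k::field) group_algebra set"
  assumes "G_code C" and "C \<noteq> {0}"
  shows "min_dist C * KG.dim C \<ge> CARD('g)
    \<and> 2 * sqrt (real CARD('g)) \<le> real (min_dist C + KG.dim C)
    \<and> min_dist C + KG.dim C \<le> CARD('g) + 1"
proof -
  have "0 \<in> C" using assms(1) by (simp add: G_code_def)
  then obtain c where c: "c \<in> C" "c \<noteq> 0" "weight c = min_dist C"
    and min: "\<And>x. x \<in> C \<Longrightarrow> x \<noteq> 0 \<Longrightarrow> min_dist C \<le> weight x"
    using min_dist_attained[OF _ assms(2)] by blast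
  have prod: "CARD('g) \<le> min_dist C * KG.dim C"
    using CARD_le_weight_mult_dim[OF assms(1) c(1,2)] c(3) by simp
  then have "real CARD('g) \<le> real (min_dist C) * real (KG.dim C)"
    by (metis of_nat_le_iff of_nat_mult)
  then have "sqrt (real CARD('g)) \<le> sqrt (real (min_dist C) * real (KG.dim C))"
    by (rule real_sqrt_le_mono)
  also have "\<dots> \<le> (real (min_dist C) + real (KG.dim C)) / 2"
    by (rule arith_geo_mean_sqrt) simp_all
  finally have "2 * sqrt (real CARD('g)) \<le> real (min_dist C + KG.dim C)" by simp
  \<comment> \<open>The minimum distance is the size of an actual support, which gives the side
    condition of \<open>singleton_bound\<close>.\<close>
  moreover have "min_dist C \<le> CARD('g)"
    using c(3) by (metis weight_def card_mono finite subset_UNIV)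
  then have "min_dist C + KG.dim C \<le> CARD('g) + 1"
    using singleton_bound[OF G_code_subspace[OF assms(1)]] min by blast
  ultimately show ?thesis using prod by blast
qed

end
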